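(* Let $(q,n)$ be a Dickson pair with $q=p^l$ for some prime $p$ and positive integers $l,n$. Let $g$ be a generator of the multiplicative group $\mathbb{F}_{q^n}^*$ and let $R=(\mathbb{F}_{q^n},+,\circ)$ be the finite Dickson nearfield constructed with $H=\langle g^n\rangle$. Let $\mathbb{F}_q$ be the unique subfield of order $q$ of the field $\mathbb{F}_{q^n}$. Then $$C(R)\subseteq \mathbb{F}_q.$$
   Context: A pair of positive integers $(q,n)$ is called a Dickson pair if: (i) $q$ is a power $p^l$ of some prime $p$; (ii) each prime divisor of $n$ divides $q-1$; (iii) $q\equiv 3 \pmod 4$ implies that $4$ does not divide $n$. For $k\in\{1,\ldots,n\}$ write $[k]_q=\frac{q^k-1}{q-1}$. A (left) nearfield is a triple $(R,+,\cdot)$ such that $(R,+)$ is a group, $(R,\cdot)$ is a semigroup, $a\cdot(b+c)=a\cdot b+a\cdot c$ for all $a,b,c\in R$, and $(R\setminus\{0\},\cdot)$ is a group. Dickson construction: let $(q,n)$ be a Dickson pair, let $g$ be a generator of the multiplicative group $\mathbb{F}_{q^n}^*$ of the finite field $\mathbb{F}_{q^n}$ (with usual multiplication $\cdot$), and let $H=\langle g^n\rangle\le \mathbb{F}_{q^n}^*$. The quotient group is $\mathbb{F}_{q^n}^*/H=\{g^{[1]_q}H,g^{[2]_q}H,\ldots,g^{[n]_q}H\}=\{H,gH,\ldots,g^{n-1}H\}$, so each $\alpha\in\mathbb{F}_{q^n}^*$ lies in $g^{[k]_q}H$ for exactly one $k\in\{1,\ldots,n\}$. Define a new multiplication on $\mathbb{F}_{q^n}$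 by $$\alpha\circ\beta=\begin{cases}\alpha\cdot\beta^{q^k} & \text{if } \alpha\in g^{[k]_q}H,\ k\in\{1,\ldots,n\},\\ 0 & \text{if }\alpha=0.\end{cases}$$ Then $(\mathbb{F}_{q^n},+,\circ)$ is a (left) nearfield, the finite Dickson nearfield arising from the Dickson pair $(q,n)$ with generator $g$, i.e. constructed with $H=\langle g^n\rangle$. For this nearfield $R=(\mathbb{F}_{q^n},+,\circ)$, the multiplicative center is $C(R)=\{x\in R: x\circ y=y\circ x\text{ for all }y\in R\}$. The field $\mathbb{F}_q$ is regarded as a subset of the underlying set $\mathbb{F}_{q^n}$ of $R$. *)

theory Defs
  imports "HOL-Algebra.Multiplicative_Group" "HOL-Algebra.Subrings"
    "HOL-Algebra.Generated_Groups" "HOL-Computational_Algebra.Primes"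
begin

definition dickson_pair :: "nat \<Rightarrow> nat \<Rightarrow> bool" where
  "dickson_pair q n \<longleftrightarrow> n > 0 \<and>
     (\<exists>p l. prime p \<and> l > 0 \<and> q = p ^ l) \<and>
     (\<forall>r. prime r \<and> r dvd n \<longrightarrow> r dvd q - 1) \<and>
     (q mod 4 = 3 \<longrightarrow> \<not> 4 dvd n)"

text \<open>The division in \<open>q_number\<close> is exact for \<open>q \<ge> 2\<close>.\<close>

definition q_number :: "nat \<Rightarrow> nat \<Rightarrow> nat" where
  "q_number q k = (q ^ k - 1) div (q - 1)"

text \<open>In the following, \<open>F\<close> is a field with \<open>q ^ n\<close> elements and \<open>g\<close> generates its
  multiplicative group \<open>mult_of F\<close>. For a Dickson pair \<open>(q, n)\<close> the cosets
  \<open>g [^] q_number q k \<cdot> H\<close> with \<open>1 \<le> k \<le> n\<close> are exactly the \<open>n\<close> distinct cosets of \<open>H\<close>,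
  so the index \<open>k\<close> of the coset of a nonzero element exists and is unique.\<close>

definition dickson_subgroup :: "('a, 'b) ring_scheme \<Rightarrow> nat \<Rightarrow> 'a \<Rightarrow> 'a set" where
  "dickson_subgroup F n g = generate (mult_of F) {g [^]\<^bsub>mult_of F\<^esub> n}"

definition dickson_index :: "('a, 'b) ring_scheme \<Rightarrow> nat \<Rightarrow> nat \<Rightarrow> 'a \<Rightarrow> 'a \<Rightarrow> nat" where
  "dickson_index F q n g a =
     (THE k. k \<in> {1..n} \<and>
        a \<in> (g [^]\<^bsub>mult_of F\<^esub> q_number q k) <#\<^bsub>mult_of F\<^esub> dickson_subgroup F n g)"

definition dickson_mult ::
  "('a, 'b) ring_scheme \<Rightarrow> nat \<Rightarrow> nat \<Rightarrow> 'a \<Rightarrow> 'a \<Rightarrow> 'a \<Rightarrow> 'a" where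
  "dickson_mult F q n g a b =
     (if a = \<zero>\<^bsub>F\<^esub> then \<zero>\<^bsub>F\<^esub>
      else a \<otimes>\<^bsub>F\<^esub> (b [^]\<^bsub>F\<^esub> (q ^ dickson_index F q n g a)))"

text \<open>The nearfield has the carrier and the addition of \<open>F\<close>. The unit of \<open>F\<close> is kept, as it is
  also the unit of the new multiplication: it lies in the coset with index \<open>n\<close>.\<close>

definition dickson_nearfield ::
  "('a, 'b) ring_scheme \<Rightarrow> nat \<Rightarrow> nat \<Rightarrow> 'a \<Rightarrow> ('a, 'b) ring_scheme" where
  "dickson_nearfield F q n g = F\<lparr>mult := dickson_mult F q n g\<rparr>"

definition multiplicative_center :: "('a, 'b) monoid_scheme \<Rightarrow> 'a set" where
  "multiplicative_center R =
     {x \<in> carrier R. \<forall>y \<in> carrier R. x \<otimes>\<^bsub>R\<^esub> y = y \<otimes>\<^bsub>R\<^esub> x}"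

end

theory Submission
  imports Defs "HOL-Number_Theory.Cong"
begin

text \<open>Let \<open>x\<close> be a nonzero central element, \<open>k\<close> its index and \<open>N = q ^ n - 1\<close>. Lifting the
  exponent at each prime divisor of \<open>n\<close> shows that \<open>n\<close> divides \<open>[k]\<^sub>q\<close> only if it divides \<open>k\<close>;
  hence \<open>g\<close> has index \<open>1\<close> and \<open>g ^ n\<close> has index \<open>n\<close>. Commuting \<open>x\<close> with \<open>g ^ n\<close> yields
  \<open>N dvd n * (q ^ k - 1)\<close>, which for reasons of size forces \<open>n dvd k\<close>. Commuting \<open>x\<close> with \<open>g\<close>
  yields \<open>x ^ (q - 1) = g ^ (q ^ k - 1)\<close>, which is then \<open>1\<close>. Since the \<open>q - 1\<close> nonzero elements
  of the subfield already exhaust the solutions of \<open>x ^ (q - 1) = 1\<close>, \<open>x\<close> is one of them.\<close>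

section \<open>Divisibility of geometric sums\<close>

lemma geometric_sum_add:
  fixes q :: "'a :: comm_semiring_1"
  shows "(\<Sum>i<m + k. q ^ i) = (\<Sum>i<m. q ^ i) + q ^ m * (\<Sum>i<k. q ^ i)"
  by (induction k) (simp_all add: algebra_simps power_add)

text \<open>The exponents below \<open>m * k\<close> split into \<open>k\<close> blocks of length
  \<open>m\<close>, each being the first one times a power of \<open>q ^ m\<close>.\<close>

lemma geometric_sum_mult:
  fixes q :: "'a :: comm_semiring_1"
  shows "(\<Sum>i<m * k. q ^ i) = (\<Sum>i<m. q ^ i) * (\<Sum>i<k. (q ^ m) ^ i)"
proof (induction k)
  case (Suc k)
  have "(\<Sum>i<m * Suc k. q ^ i) = (\<Sum>i<m * k. q ^ i) + q ^ (m * k) * (\<Sum>i<m. q ^ i)"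
    using geometric_sum_add[of q "m * k" m] by (simp only: mult_Suc_right add.commute)
  then show ?case
    unfolding Suc.IH power_mult by (simp only: sum.lessThan_Suc distrib_left mult.commute)
qed simp

lemma q_number_eq_sum:
  assumes "q \<ge> 2"
  shows "q_number q k = (\<Sum>i<k. q ^ i)"
proof -
  have "q ^ k - 1 = (q - 1) * (\<Sum>i<k. q ^ i)"
    using power_diff_1_eq[of "int q" k] assms
    by (simp flip: of_nat_eq_iff[where 'a = int])
  then show ?thesis using assms by (simp add: q_number_def)
qed

lemma cong_geometric_sum:
  fixes q r :: nat
  assumes "[q = 1] (mod r)"
  shows "[(\<Sum>i<k. q ^ i) = k] (mod r)"
proof -
  have "[(\<Sum>i<k. q ^ i) = (\<Sum>i<k. 1)] (mod r)"
    by (intro cong_sum) (use cong_pow[OF assms] in simp)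
  then show ?thesis by simp
qed

text \<open>For odd \<open>r\<close>, expand \<open>q = 1 + r * u\<close> to first order: modulo
  \<open>r\<^sup>2\<close> the sum is \<open>r\<close> plus \<open>r * u\<close> times the
  triangular number r(r-1)/2, itself a multiple of \<open>r\<close>. For \<open>r = 2\<close> the
  sum is \<open>1 + q\<close>, which is 2 modulo 4.\<close>

lemma not_square_dvd_geometric_sum:
  fixes q r :: nat
  assumes r: "Factorial_Ring.prime r" and q: "[q = 1] (mod r)" and q4: "r = 2 \<Longrightarrow> [q = 1] (mod 4)"
  shows "\<not> r\<^sup>2 dvd (\<Sum>i<r. q ^ i)"
proof (cases "r = 2")
  case True
  have "[(\<Sum>i<2. q ^ i) = 2] (mod 4)"
    using cong_add[OF cong_refl[of 1] q4[OF True]] by (simp add: numeral_2_eq_2)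
  then have "\<not> 4 dvd (\<Sum>i<2. q ^ i)"
    by (simp only: cong_dvd_iff) simp
  then show ?thesis by (simp add: True)
next
  case False
  have "int r dvd int q - 1"
    using q by (simp add: cong_iff_dvd_diff flip: cong_int_iff)
  then obtain u :: int where u: "int q = 1 + r * u" by (auto simp: dvd_def algebra_simps)
  have *: "[int q ^ i = 1 + i * r * u] (mod r\<^sup>2)" for i
  proof (induction i)
    case (Suc i)
    have "[int q * int q ^ i = int q * (1 + i * r * u)] (mod r\<^sup>2)"
      by (intro cong_mult cong_refl Suc)
    also have "int q * (1 + i * r * u) = (1 + Suc i * r * u) + r\<^sup>2 * (i * u\<^sup>2)"
      unfolding u by (simp add: algebra_simps power2_eq_square)
    also have "[\<dots> = 1 + Suc i * r * u] (mod r\<^sup>2)"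
      by (simp add: cong_def)
    finally show ?case by simp
  qed simp
  \<comment> \<open>Oddness makes (r-1)/2 the integer \<open>v\<close>.\<close>
  obtain v where v: "r = 2 * v + 1"
    using r False prime_odd_nat[of r] prime_ge_2_nat[of r] by (auto elim!: oddE)
  have "2 * (\<Sum>i<s. int i) = int s * (int s - 1)" for s :: nat
    by (induction s) (simp_all add: algebra_simps)
  from this[of r] have sumid: "(\<Sum>i<r. int i) = int r * v"
    using v by simp
  have "[(\<Sum>i<r. int q ^ i) = (\<Sum>i<r. 1 + i * r * u)] (mod r\<^sup>2)"
    by (intro cong_sum *)
  also have "(\<Sum>i<r. 1 + i * r * u) = int r + (\<Sum>i<r. int i) * (int r * u)"
    by (simp add: sum.distrib sum_distrib_right mult.assoc)
  also have "\<dots> = int r + r\<^sup>2 * (v * u)"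
    by (simp add: sumid power2_eq_square)
  also have "[\<dots> = int r] (mod r\<^sup>2)"
    by (simp add: cong_def)
  finally have "[int (\<Sum>i<r. q ^ i) = int r] (mod int (r\<^sup>2))" by simp
  then have "[(\<Sum>i<r. q ^ i) = r] (mod r\<^sup>2)" unfolding cong_int_iff .
  moreover have "\<not> r\<^sup>2 dvd r"
    using prime_gt_1_nat[OF r] by (auto dest!: dvd_imp_le simp: power2_eq_square)
  ultimately show ?thesis using cong_dvd_iff by blast
qed

text \<open>For \<open>k = r * t\<close> the sum factors into one of length \<open>r\<close>, which
  contains \<open>r\<close> exactly once, and one of length \<open>t\<close> with base
  \<open>q ^ r\<close>. The induction on \<open>a\<close> therefore has to vary
  \<open>q\<close>.\<close>

lemma prime_power_dvd_geometric_sum_iff: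
  fixes q r :: nat
  assumes r: "Factorial_Ring.prime r" and "[q = 1] (mod r)" and "r = 2 \<Longrightarrow> [q = 1] (mod 4)"
  shows "r ^ a dvd (\<Sum>i<k. q ^ i) \<longleftrightarrow> r ^ a dvd k"
  using assms(2,3)
proof (induction a arbitrary: q k)
  case 0
  show ?case by simp
next
  case (Suc a)
  have dvd_iff: "r dvd (\<Sum>i<k. q ^ i) \<longleftrightarrow> r dvd k" for k
    using Suc.prems(1) by (intro cong_dvd_iff cong_geometric_sum)
  show ?case
  proof (cases "r dvd k")
    case False
    with dvd_iff[of k] show ?thesis by (auto dest: dvd_mult_left)
  next
    case True
    then obtain t where t: "k = r * t" by blast
    obtain w where w: "(\<Sum>i<r. q ^ i) = r * w" using dvd_iff[of r] by auto
    have "\<not> r dvd w"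
      using not_square_dvd_geometric_sum[OF r Suc.prems] w prime_gt_0_nat[OF r]
      by (simp add: power2_eq_square)
    then have cop: "coprime (r ^ a) w"
      using prime_imp_coprime[OF r, of w] by simp
    have "(\<Sum>i<k. q ^ i) = r * (w * (\<Sum>i<t. (q ^ r) ^ i))"
      by (simp only: t geometric_sum_mult w mult.assoc)
    then have "r ^ Suc a dvd (\<Sum>i<k. q ^ i) \<longleftrightarrow> r ^ a dvd (\<Sum>i<t. (q ^ r) ^ i)"
      using prime_gt_0_nat[OF r] cop by (simp add: coprime_dvd_mult_right_iff)
    also have "\<dots> \<longleftrightarrow> r ^ a dvd t"
      using cong_pow[OF Suc.prems(1), of r] cong_pow[OF Suc.prems(2), of r] by (intro Suc.IH) auto
    finally show ?thesis using t prime_gt_0_nat[OF r] by simp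
  qed
qed

text \<open>Lets the exponent be lifted one prime at a time.\<close>

lemma dvd_iff_prime_powers_dvd:
  fixes n x :: nat
  assumes "n > 0"
  shows "n dvd x \<longleftrightarrow> (\<forall>r. Factorial_Ring.prime r \<longrightarrow> r ^ multiplicity r n dvd x)"
proof (cases "x = 0")
  case False
  show ?thesis
  proof (intro iffI allI impI)
    fix r :: nat assume "n dvd x"
    with multiplicity_dvd show "r ^ multiplicity r n dvd x" by (rule dvd_trans)
  next
    assume *: "\<forall>r. Factorial_Ring.prime r \<longrightarrow> r ^ multiplicity r n dvd x"
    show "n dvd x"
    proof (rule multiplicity_le_imp_dvd)
      show "n \<noteq> 0" using assms by simp
      fix r :: nat assume r: "Factorial_Ring.prime r"
      then have "r ^ multiplicity r n dvd x" using * by blast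
      moreover have "\<not> is_unit r" using not_prime_unit r by auto
      ultimately show "multiplicity r n \<le> multiplicity r x"
        using False by (intro multiplicity_geI)
    qed
  qed
qed simp

section \<open>Dickson pairs\<close>

lemma dickson_pair_ge_2:
  assumes "dickson_pair q n"
  shows "q \<ge> 2"
proof -
  obtain p l :: nat where "Factorial_Ring.prime p" "l > 0" "q = p ^ l"
    using assms by (auto simp: dickson_pair_def)
  then show ?thesis
    using prime_ge_2_nat[of p] self_le_power[of p l] by auto
qed

text \<open>Lifting applies at every prime divisor of \<open>n\<close>, except at 2 when
  \<open>q\<close> is 3 modulo 4. There the third Dickson condition bounds the power of 2 in
  \<open>n\<close>.\<close>

lemma dickson_pair_dvd_q_number_iff:
  assumes "dickson_pair q n"
  shows "n dvd q_number q k \<longleftrightarrow> n dvd k"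
proof -
  have n: "n > 0" and dvd: "\<And>r. Factorial_Ring.prime r \<Longrightarrow> r dvd n \<Longrightarrow> r dvd q - 1"
    and mod4: "q mod 4 = 3 \<Longrightarrow> \<not> 4 dvd n"
    using assms by (auto simp: dickson_pair_def)
  note q = dickson_pair_ge_2[OF assms]
  have "r ^ multiplicity r n dvd (\<Sum>i<k. q ^ i) \<longleftrightarrow> r ^ multiplicity r n dvd k"
    if r: "Factorial_Ring.prime r" for r
  proof (cases "r dvd n")
    case False
    then show ?thesis by (simp add: not_dvd_imp_multiplicity_0)
  next
    case True
    have q1: "[q = 1] (mod r)"
      using dvd[OF r True] q by (simp add: cong_altdef_nat)
    show ?thesis
    proof (cases "r = 2 \<longrightarrow> [q = 1] (mod 4)")
      case True
      then show ?thesis using prime_power_dvd_geometric_sum_iff[OF r q1] by blast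
    next
      case False
      then have r2: "r = 2" and "q mod 4 \<noteq> 1" by (auto simp: cong_def)
      with q1 have "q mod 4 = 3" unfolding cong_def by presburger
      from mod4[OF this] have "\<not> 2 ^ 2 dvd n" by simp
      \<comment> \<open>At most one factor 2 has to be handled, so the congruence modulo 2 is
        enough.\<close>
      then have "multiplicity r n < 2"
        using n r2 by (auto intro: multiplicity_lessI)
      moreover have "r dvd (\<Sum>i<k. q ^ i) \<longleftrightarrow> r dvd k"
        using q1 by (intro cong_dvd_iff cong_geometric_sum)
      ultimately show ?thesis
        by (cases "multiplicity r n = 0") (auto simp: less_2_cases_iff)
    qed
  qed
  then show ?thesis
    unfolding q_number_eq_sum[OF q] using dvd_iff_prime_powers_dvd[OF n] by simp
qed

text \<open>Identifies the index of \<open>g\<close>. Since [k] = 1 + q [k-1] and \<open>q\<close>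
  is coprime to \<open>n\<close>, the congruence forces \<open>n\<close> to divide k-1, which is
  less than \<open>n\<close>.\<close>

lemma dickson_pair_cong_1_q_number_iff:
  assumes dp: "dickson_pair q n" and k: "k \<in> {1..n}"
  shows "[q_number q k = 1] (mod n) \<longleftrightarrow> k = 1"
proof
  note q = dickson_pair_ge_2[OF dp]
  assume *: "[q_number q k = 1] (mod n)"
  obtain j where j: "k = Suc j" using k by (cases k) auto
  have "q_number q k = 1 + q * q_number q j"
    unfolding q_number_eq_sum[OF q] using geometric_sum_add[where m = 1 and k = j and q = q] j by simp
  with * have "n dvd q * q_number q j"
    by (simp add: cong_altdef_nat)
  moreover have "coprime n q"
  proof (rule ccontr)
    assume "\<not> coprime n q"
    then obtain r where r: "Factorial_Ring.prime r" "r dvd n" "r dvd q"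
      using prime_factor_nat[of "gcd n q"] by (auto simp: coprime_iff_gcd_eq_1)
    then have "r dvd q - 1" using dp by (simp add: dickson_pair_def)
    with r q have "r dvd 1" using dvd_diff_nat[of r q "q - 1"] by simp
    with r show False by auto
  qed
  ultimately have "n dvd j"
    by (simp add: coprime_dvd_mult_right_iff dickson_pair_dvd_q_number_iff[OF dp])
  with j k show "k = 1" using nat_dvd_not_less[of j n] by (cases j) auto
qed (use dickson_pair_ge_2[OF dp] in \<open>simp add: q_number_def\<close>)

text \<open>If \<open>2 * j \<le> n\<close>, the right-hand side is positive but smaller than
  \<open>q ^ n - 1\<close>. Larger \<open>j\<close> reduce to \<open>n - j\<close>.\<close>

lemma not_dvd_mult_power_minus_1:
  fixes q :: int
  assumes q: "q \<ge> 2" and j: "0 < j" "j < n"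
  shows "\<not> (q ^ n - 1) dvd int n * (q ^ j - 1)"
proof -
  have *: "\<not> (q ^ n - 1) dvd int n * (q ^ j - 1)" if j: "0 < j" "2 * j \<le> n" for j
  proof
    assume "(q ^ n - 1) dvd int n * (q ^ j - 1)"
    moreover have qj: "q ^ j > 1" using q j by (simp add: one_less_power)
    ultimately have le: "q ^ n - 1 \<le> int n * (q ^ j - 1)"
      using j by (intro zdvd_imp_le mult_pos_pos) simp_all
    have pow2: "2 * m \<le> 2 ^ m" if "m \<ge> 1" for m :: nat
      using that by (induction m rule: dec_induct) simp_all
    \<comment> \<open>Because \<open>2 * j \<le> n\<close> gives
      \<open>n \<le> 2 * (n - j)\<close>.\<close>
    have "n \<le> 2 ^ (n - j)" using pow2[of "n - j"] j by linarith
    then have "int n \<le> 2 ^ (n - j)" by (metis of_nat_le_iff of_nat_numeral of_nat_power)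
    also have "\<dots> \<le> q ^ (n - j)" using q by (intro power_mono) simp_all
    finally have "int n < q ^ (n - j) + 1" by simp
    with qj have less: "int n * (q ^ j - 1) < (q ^ (n - j) + 1) * (q ^ j - 1)"
      by (intro mult_strict_right_mono) simp_all
    have "q ^ (n - j) * q ^ j = q ^ n" using j by (simp flip: power_add)
    then have "(q ^ (n - j) + 1) * (q ^ j - 1) = q ^ n - 1 + (q ^ j - q ^ (n - j))"
      by (simp add: algebra_simps)
    moreover have "q ^ j \<le> q ^ (n - j)" using q j by (intro power_increasing) simp_all
    ultimately show False using le less by linarith
  qed
  show ?thesis
  proof (cases "2 * j \<le> n")
    case True
    then show ?thesis using * j by blast
  next
    case False
    have qn: "q ^ (n - j) * q ^ j = q ^ n" using j by (simp flip: power_add)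
    \<comment> \<open>Modulo \<open>q ^ n - 1\<close> the inverse of \<open>q ^ j\<close> is
      \<open>q ^ (n - j)\<close>, so divisibility passes from \<open>j\<close> to
      \<open>n - j\<close>.\<close>
    have eq: "int n * (q ^ (n - j) - 1) = int n * (q ^ n - 1) - q ^ (n - j) * (int n * (q ^ j - 1))"
      unfolding qn[symmetric] by (simp add: algebra_simps)
    show ?thesis
    proof
      assume "(q ^ n - 1) dvd int n * (q ^ j - 1)"
      then have "(q ^ n - 1) dvd int n * (q ^ (n - j) - 1)"
        unfolding eq by (simp only: dvd_diff dvd_mult dvd_triv_right)
      moreover have "0 < n - j" "2 * (n - j) \<le> n" using False j by linarith+
      ultimately show False using *[of "n - j"] by blast
    qed
  qed
qed

text \<open>Reducing the exponent modulo \<open>n\<close> removes any bound on \<open>k\<close>, so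
  this applies to an index without locating it in \<open>{1..n}\<close>.\<close>

lemma dvd_mult_power_minus_1_imp_dvd:
  fixes q :: int
  assumes q: "q \<ge> 2" and n: "n > 0" and dvd: "(q ^ n - 1) dvd int n * (q ^ k - 1)"
  shows "n dvd k"
proof (rule ccontr)
  assume "\<not> n dvd k"
  then have k: "0 < k mod n" "k mod n < n" using n by (auto simp: mod_greater_zero_iff_not_dvd)
  have "[(q ^ n) ^ (k div n) * q ^ (k mod n) = 1 ^ (k div n) * q ^ (k mod n)] (mod (q ^ n - 1))"
    by (intro cong_mult cong_pow cong_refl) (simp add: cong_iff_dvd_diff)
  then have "[q ^ k = q ^ (k mod n)] (mod (q ^ n - 1))"
    by (simp flip: power_mult power_add)
  then have "[int n * (q ^ k - 1) = int n * (q ^ (k mod n) - 1)] (mod (q ^ n - 1))"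
    by (intro cong_mult cong_diff cong_refl)
  with dvd not_dvd_mult_power_minus_1[OF q k] show False
    by (simp only: cong_dvd_iff)
qed

section \<open>Finite fields\<close>

lemma (in group) pow_eq_iff_cong:
  fixes a b :: nat
  assumes "x \<in> carrier G"
  shows "x [^] a = x [^] b \<longleftrightarrow> [int a = int b] (mod int (ord x))"
  using int_pow_eq[OF assms, of "int a" "int b"]
  by (simp add: int_pow_int cong_iff_dvd_diff dvd_diff_commute)

text \<open>By Lagrange every nonzero element of \<open>K\<close> is such a root, and the degree
  bound on the number of roots leaves room for no others.\<close>

lemma (in field) subfield_eq_roots_of_unity:
  assumes fin: "finite (carrier R)" and K: "subfield K R" and card: "card K > 1"
  shows "{x \<in> carrier R. x [^] (card K - 1) = \<one>} = K - {\<zero>}"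
proof -
  interpret K: field "R\<lparr>carrier := K\<rparr>" using subfield_iff(2)[OF K] .
  interpret M: group "mult_of (R\<lparr>carrier := K\<rparr>)" by (rule K.field_mult_group)
  have K_sub: "K \<subseteq> carrier R" using subfieldE(3)[OF K] .
  have K0: "\<zero> \<in> K" using K.zero_closed by simp
  have ord: "order (mult_of (R\<lparr>carrier := K\<rparr>)) = card K - 1"
    using K0 finite_subset[OF K_sub fin] by (simp add: order_def)
  have pow: "x [^]\<^bsub>mult_of (R\<lparr>carrier := K\<rparr>)\<^esub> m = x [^] m" for x and m :: nat
    by (simp add: nat_pow_mult_of nat_pow_def)
  have "x [^] (card K - 1) = \<one>" if "x \<in> K - {\<zero>}" for x
    using M.pow_order_eq_1[of x] that unfolding ord pow by simp
  then have sub: "K - {\<zero>} \<subseteq> {x \<in> carrier R. x [^] (card K - 1) = \<one>}"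
    using K_sub by blast
  have "card {x \<in> carrier R. x [^] (card K - 1) = \<one>} \<le> card (K - {\<zero>})"
    using num_roots_le_deg[OF fin, of "card K - 1"] card K0 by simp
  with sub show ?thesis using fin card_seteq[OF _ sub] by auto
qed

section \<open>The center of a Dickson nearfield\<close>

theorem theorem2p9:
  fixes F :: "('a, 'b) ring_scheme" and Fq :: "'a set" and g :: 'a
    and p l q n :: nat
  assumes "Factorial_Ring.prime p" and "l > 0" and "n > 0" and "q = p ^ l"
    and "dickson_pair q n"
    and "field F" and "order F = q ^ n"
    and "g \<in> carrier (Multiplicative_Group.mult_of F)"
    and "generate (Multiplicative_Group.mult_of F) {g} = carrier (Multiplicative_Group.mult_of F)"
    and "subfield Fq F" and "card Fq = q"
  shows "multiplicative_center (dickson_nearfield F q n g) \<subseteq> Fq"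
proof
  fix x assume x: "x \<in> multiplicative_center (dickson_nearfield F q n g)"
  interpret F: field F by fact
  let ?M = "mult_of F"
  interpret M: group ?M by (rule F.field_mult_group)
  note dp = assms(5) and g = assms(8)
  note q = dickson_pair_ge_2[OF dp]
  have qn: "q ^ n \<ge> 2" using q self_le_power[of q n] assms(3) by linarith
  have fin: "finite (carrier F)"
    using assms(7) qn by (intro card_ge_0_finite) (unfold order_def, linarith)
  define N where "N = q ^ n - 1"
  have order: "order ?M = N" using F.order_mult_of[OF fin] assms(7) N_def by simp
  have ord: "M.ord g = N"
    using M.generate_pow_card[OF g] assms(9) order by (simp add: order_def)
  have intN: "int N = int q ^ n - 1" using qn by (simp add: N_def of_nat_diff)
  have pow_g: "g [^]\<^bsub>?M\<^esub> a = g [^]\<^bsub>?M\<^esub> b \<longleftrightarrow> [int a = int b] (mod int N)" for a b :: nat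
    using M.pow_eq_iff_cong[OF g] ord by simp
  \<comment> \<open>Exponents of \<open>g\<close> matter only modulo \<open>N\<close>; this makes
    their residues modulo \<open>n\<close> well defined, so that they can label the cosets.\<close>
  have n_dvd_N: "n dvd N"
  proof -
    have "N = (q - 1) * q_number q n"
      using power_diff_1_eq[of "int q" n] q intN unfolding q_number_eq_sum[OF q]
      by (simp add: of_nat_diff flip: of_nat_eq_iff[where 'a = int])
    then show ?thesis using dickson_pair_dvd_q_number_iff[OF dp, of n] by simp
  qed
  have coset: "g [^]\<^bsub>?M\<^esub> m \<in> (g [^]\<^bsub>?M\<^esub> c) <#\<^bsub>?M\<^esub> dickson_subgroup F n g
      \<longleftrightarrow> [c = m] (mod n)" for m c :: nat
  proof -
    have "dickson_subgroup F n g = {g [^]\<^bsub>?M\<^esub> (n * i) | i. i \<in> (UNIV :: nat set)}"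
      unfolding dickson_subgroup_def
      using M.generate_pow_on_finite_carrier[OF F.finite_mult_of[OF fin] M.nat_pow_closed[OF g]]
      by (simp only: M.nat_pow_pow[OF g])
    then have "g [^]\<^bsub>?M\<^esub> m \<in> (g [^]\<^bsub>?M\<^esub> c) <#\<^bsub>?M\<^esub> dickson_subgroup F n g
        \<longleftrightarrow> (\<exists>i. g [^]\<^bsub>?M\<^esub> m = g [^]\<^bsub>?M\<^esub> (c + n * i))"
      using M.nat_pow_mult[OF g] by (auto simp: l_coset_def simp del: mult_mult_of)
    also have "\<dots> \<longleftrightarrow> [c = m] (mod n)"
    proof
      assume "\<exists>i. g [^]\<^bsub>?M\<^esub> m = g [^]\<^bsub>?M\<^esub> (c + n * i)"
      then obtain i where "[int m = int (c + n * i)] (mod int N)" unfolding pow_g by blast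
      then have "[m = c + n * i] (mod n)"
        using n_dvd_N unfolding cong_int_iff by (rule cong_dvd_modulus_nat)
      then show "[c = m] (mod n)" by (simp add: cong_def)
    next
      assume c: "[c = m] (mod n)"
      \<comment> \<open>adding the multiple \<open>N * c\<close> of \<open>N\<close> to \<open>m\<close> makes the exponent at least \<open>c\<close>\<close>
      have N1: "N \<ge> 1" using qn by (simp add: N_def)
      then have le: "c \<le> m + N * c" by (simp add: trans_le_add2)
      have "[c = m + N * c] (mod n)"
        using c n_dvd_N by (auto simp: cong_def dvd_def mult.assoc)
      then obtain i where i: "m + N * c = c + n * i"
        using le by (auto simp: cong_le_nat cong_sym_eq[of c] ac_simps)
      have "[int m = int (m + N * c)] (mod int N)" by (simp add: cong_def)
      then show "\<exists>i. g [^]\<^bsub>?M\<^esub> m = g [^]\<^bsub>?M\<^esub> (c + n * i)"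
        unfolding i pow_g by blast
    qed
    finally show ?thesis .
  qed
  have index: "dickson_index F q n g (g [^]\<^bsub>?M\<^esub> m)
      = (THE k. k \<in> {1..n} \<and> [q_number q k = m] (mod n))" for m :: nat
    by (simp only: dickson_index_def coset)
  have index_g: "dickson_index F q n g (g [^]\<^bsub>?M\<^esub> (1::nat)) = 1"
    unfolding index using dickson_pair_cong_1_q_number_iff[OF dp] assms(3)
    by (intro the_equality) auto
  have index_gn: "dickson_index F q n g (g [^]\<^bsub>?M\<^esub> n) = n"
  proof -
    \<comment> \<open>Indices start at 1, so the trivial coset has index \<open>n\<close> rather
      than 0.\<close>
    have "[q_number q k = n] (mod n) \<longleftrightarrow> n dvd k" for k
      using dickson_pair_dvd_q_number_iff[OF dp, of k] by (simp add: cong_def mod_eq_0_iff_dvd)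
    then show ?thesis
      unfolding index using assms(3) by (intro the_equality) (auto dest: dvd_imp_le)
  qed
  show "x \<in> Fq"
  proof (cases "x = \<zero>\<^bsub>F\<^esub>")
    case True
    then show ?thesis using subringE(2)[OF subfieldE(1)[OF assms(10)]] by simp
  next
    case False
    have xF: "x \<in> carrier F"
      and comm: "\<And>y. y \<in> carrier F \<Longrightarrow> dickson_mult F q n g x y = dickson_mult F q n g y x"
      using x by (auto simp: multiplicative_center_def dickson_nearfield_def)
    have xM: "x \<in> carrier ?M" using xF False by simp
    then obtain m :: nat where m: "x = g [^]\<^bsub>?M\<^esub> m"
      using M.generate_pow_on_finite_carrier[OF F.finite_mult_of[OF fin] g] assms(9) by auto
    define k where "k = dickson_index F q n g x"
    \<comment> \<open>Commutation of \<open>x\<close> with \<open>g ^ a\<close>, read off in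
      exponents of \<open>g\<close>: \<open>x\<close> raises its right factor to the power
      \<open>q ^ k\<close>, and \<open>g ^ a\<close> to the power \<open>q ^ j\<close>.\<close>
    have key: "[int (m + a * q ^ k) = int (a + m * q ^ j)] (mod int N)"
      if j: "dickson_index F q n g (g [^]\<^bsub>?M\<^esub> a) = j" for a j :: nat
    proof -
      let ?y = "g [^]\<^bsub>?M\<^esub> a"
      have y: "?y \<in> carrier ?M" using g by (rule M.nat_pow_closed)
      then have "dickson_mult F q n g x ?y = dickson_mult F q n g ?y x"
        by (intro comm) simp
      then have "x \<otimes>\<^bsub>?M\<^esub> ?y [^]\<^bsub>?M\<^esub> (q ^ k) = ?y \<otimes>\<^bsub>?M\<^esub> x [^]\<^bsub>?M\<^esub> (q ^ j)"
        using y False j by (simp add: dickson_mult_def k_def nat_pow_mult_of)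
      then show ?thesis
        unfolding m M.nat_pow_pow[OF g] M.nat_pow_mult[OF g] pow_g .
    qed
    \<comment> \<open>Having index \<open>n\<close>, the element \<open>g ^ n\<close> acts on
      \<open>x\<close> by the power \<open>q ^ n\<close>, which is the identity; the two terms in
      \<open>m\<close> then cancel.\<close>
    have "[int q ^ n = 1] (mod int N)" by (simp add: intN cong_iff_dvd_diff)
    then have "[int n + int m * int q ^ n = int n + int m * 1] (mod int N)"
      by (intro cong_add cong_mult cong_refl)
    with key[OF index_gn] have "[int m + int n * int q ^ k = int n + int m] (mod int N)"
      by (simp add: cong_def)
    then have "(int q ^ n - 1) dvd int n * (int q ^ k - 1)"
      by (simp add: cong_iff_dvd_diff intN algebra_simps)
    then have "n dvd k"
      using dvd_mult_power_minus_1_imp_dvd[of "int q" n k] q assms(3) by simp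
    then obtain t where t: "k = n * t" by blast
    \<comment> \<open>Now \<open>x\<close> also acts trivially on its right factor, so commuting
      with \<open>g\<close>, of index 1, leaves m + 1 = 1 + m q modulo \<open>N\<close>.\<close>
    have "[int q ^ k = 1] (mod int N)"
      using cong_pow[OF \<open>[int q ^ n = 1] (mod int N)\<close>, of t] by (simp add: t power_mult)
    then have "[int m + int q ^ k = int m + 1] (mod int N)"
      by (intro cong_add cong_refl)
    with key[OF index_g] have "[1 + int m * int q = int m + 1] (mod int N)"
      by (simp add: cong_def)
    then have "[int (m * (q - 1)) = int 0] (mod int N)"
      using q by (simp add: cong_iff_dvd_diff of_nat_diff algebra_simps)
    then have "g [^]\<^bsub>?M\<^esub> (m * (q - 1)) = \<one>\<^bsub>?M\<^esub>"
      using pow_g[of "m * (q - 1)" 0] by simp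
    then have "x [^]\<^bsub>F\<^esub> (q - 1) = \<one>\<^bsub>F\<^esub>"
      unfolding m M.nat_pow_pow[OF g, symmetric] by (simp add: nat_pow_mult_of)
    then show ?thesis
      using F.subfield_eq_roots_of_unity[OF fin assms(10)] assms(11) q xF by auto
  qed
qed

end
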